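(* Let $m,n\in\mathbb{N}$, let $\Lambda\in\mathbb{R}^{m\times n}$ be a nonresonant matrix, and let $f:\mathbb{R}^m\to\mathbb{R}$ satisfy: (a) $f$ is unit periodic with respect to its $m$ variables, i.e. $f(u+z)=f(u)$ for all $u\in\mathbb{R}^m$, $z\in\mathbb{Z}^m$; (b) $f$ is $\mathrm{mes}_m$-continuous; (c) $f$ is bounded. Then the function $f\circ\Lambda:\mathbb{Z}^n\to\mathbb{R}$, $x\mapsto f(\Lambda x)$, is averageable, and its average value is $$\mathbf{A}(f\circ\Lambda)=\int_{[0,1]^m}f(u)\,\mathrm{d}u.$$
   Context: $\mathbb{N}=\{1,2,3,\ldots\}$ and $\mathrm{mes}_m$ is the $m$-dimensional Lebesgue measure. For $a\in\mathbb{Z}^n$ and $\ell\in\mathbb{N}^n$ let $P_{a,\ell}=\{x\in\mathbb{Z}^n:\ a_k\le x_k<a_k+\ell_k \text{ for all }1\le k\le n\}$, and for $N\in\mathbb{N}$ let $\mathcal{P}_N=\{P_{a,\ell}:\ a\in\mathbb{Z}^n,\ \ell\in\mathbb{N}^n,\ \min_k\ell_k\ge N\}$. For a bounded function $f:\mathbb{Z}^n\to\mathbb{R}$ and a nonempty finite $P\subset\mathbb{Z}^n$ put $W(f,P)=\frac{1}{\#P}\sum_{x\in P}f(x)$, and $\mathbf{A}_*(f)=\sup_{N\ge1}\inf_{P\in\mathcal{P}_N}W(f,P)$, $\mathbf{A}^*(f)=\inf_{N\ge1}\sup_{P\in\mathcal{P}_N}W(f,P)$. The function $f$ is averageable if $\mathbf{A}_*(f)=\mathbf{A}^*(f)$;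 the common value is the average value $\mathbf{A}(f)$. A matrix $\Lambda\in\mathbb{R}^{m\times n}$ is nonresonant if the $n+m$ rows of the matrix $\begin{bmatrix}I_n\\ \Lambda\end{bmatrix}$ are linearly independent over the field of rationals. A function on $\mathbb{R}^m$ is $\mathrm{mes}_m$-continuous if its set of discontinuity points has zero $m$-dimensional Lebesgue measure. *)

theory Defs
  imports "HOL-Analysis.Analysis"
begin

definition lattice_block :: "int^'n \<Rightarrow> nat^'n \<Rightarrow> (int^'n) set" where
  "lattice_block a l = {x. \<forall>k. a $ k \<le> x $ k \<and> x $ k < a $ k + int (l $ k)}"

text \<open>The side lengths are positive integers, whereas type \<^typ>\<open>nat\<close> contains zero.\<close>

definition lattice_blocks :: "nat \<Rightarrow> (int^'n::finite) set set" where
  "lattice_blocks N =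
    {lattice_block a l | a l. (\<forall>k. 1 \<le> l $ k) \<and> N \<le> Min (range (\<lambda>k. l $ k))}"

definition block_mean :: "(int^'n \<Rightarrow> real) \<Rightarrow> (int^'n) set \<Rightarrow> real" where
  "block_mean f P = (\<Sum>x\<in>P. f x) / real (card P)"

text \<open>
  Suprema and infima below are taken in the reals; they carry their usual meaning
  only for bounded functions, and \<open>averageable\<close> includes boundedness for this reason.
\<close>

definition lower_average :: "(int^'n::finite \<Rightarrow> real) \<Rightarrow> real" where
  "lower_average f = (SUP N\<in>{1..}. INF P\<in>lattice_blocks N. block_mean f P)"

definition upper_average :: "(int^'n::finite \<Rightarrow> real) \<Rightarrow> real" where
  "upper_average f = (INF N\<in>{1..}. SUP P\<in>lattice_blocks N. block_mean f P)"

definition averageable :: "(int^'n::finite \<Rightarrow> real) \<Rightarrow> bool" where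
  "averageable f \<longleftrightarrow> bounded (range f) \<and> lower_average f = upper_average f"

text \<open>Meaningful only for averageable functions, where it is the common value.\<close>

definition average_value :: "(int^'n::finite \<Rightarrow> real) \<Rightarrow> real" where
  "average_value f = lower_average f"

definition real_vec :: "int^'n \<Rightarrow> real^'n" where
  "real_vec z = (\<chi> i. real_of_int (z $ i))"

definition stack_identity :: "real^'n^'m \<Rightarrow> real^'n^('n + 'm)" where
  "stack_identity \<Lambda> = (\<chi> i. case i of Inl j \<Rightarrow> mat 1 $ j | Inr k \<Rightarrow> \<Lambda> $ k)"

lemma vector_space_over_rat:
  "vector_space (\<lambda>(q::rat) (v::real^'n::finite). of_rat q *\<^sub>R v)"
  by unfold_locales (simp_all add: algebra_simps of_rat_add of_rat_mult)

text \<open>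
  Independence is that of the indexed family of rows, so repeated rows count as
  dependent; \<open>rows\<close> is only a set, hence the injectivity condition.
\<close>

definition nonresonant :: "real^'n::finite^'m::finite \<Rightarrow> bool" where
  "nonresonant \<Lambda> \<longleftrightarrow>
    inj (\<lambda>i. row i (stack_identity \<Lambda>)) \<and>
    \<not> module.dependent (\<lambda>(q::rat) v. of_rat q *\<^sub>R v) (rows (stack_identity \<Lambda>))"

definition unit_periodic :: "(real^'m \<Rightarrow> real) \<Rightarrow> bool" where
  "unit_periodic f \<longleftrightarrow> (\<forall>u z. f (u + real_vec z) = f u)"

definition mes_continuous :: "(real^'m::finite \<Rightarrow> real) \<Rightarrow> bool" where
  "mes_continuous f \<longleftrightarrow> {u. \<not> isCont f u} \<in> null_sets lebesgue"

end

theory Submission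
  imports Defs
begin

text \<open>
  The mean of a nontrivial character of the torus along the orbit is a product of one-dimensional
  geometric means. Nonresonance makes one of the frequencies non-integral, so that this product is
  at most a constant divided by the shortest side of the block. Hence trigonometric polynomials
  average to their integrals, and by the Stone-Weierstrass theorem so do continuous functions on the
  torus. A bounded almost everywhere continuous \<open>f\<close> lies below its Lipschitz envelopes
  \<open>u \<mapsto> SUP v. f v - n * dist u v\<close>, which decrease to \<open>f\<close> at its continuity points; dominated
  convergence then bounds the upper limit of the means of \<open>f\<close> by its integral, and the
  same bound for \<open>- f\<close> gives the lower limit.
\<close>

section \<open>Averages as limits over large blocks\<close>

text \<open>The classes \<open>lattice_blocks N\<close> shrink as \<open>N\<close> grows, so they
  generate a filter. Convergence of \<open>block_mean f\<close> along it replaces the nested suprema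
  and infima.\<close>

definition large_blocks :: "(int^'n::finite) set filter" where
  "large_blocks = (INF N\<in>{1..}. principal (lattice_blocks N))"

lemma lattice_blocks_iff:
  "P \<in> lattice_blocks N \<longleftrightarrow> (\<exists>a l. P = lattice_block a l \<and> (\<forall>k. 1 \<le> l $ k \<and> N \<le> l $ k))"
  by (auto simp: lattice_blocks_def)

lemma lattice_blocks_antimono: "N \<le> M \<Longrightarrow> lattice_blocks M \<subseteq> lattice_blocks N"
  unfolding subset_iff lattice_blocks_iff by (metis order_trans)

text \<open>The infimum runs over a directed family: the class of \<open>max N M\<close> is
  contained in those of \<open>N\<close> and \<open>M\<close>, so one index suffices.\<close>

lemma eventually_large_blocks:
  "eventually Q large_blocks \<longleftrightarrow> (\<exists>N\<ge>1. \<forall>P\<in>lattice_blocks N. Q P)"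
proof -
  have "\<exists>x\<in>{1..}. principal (lattice_blocks x)
      \<le> inf (principal (lattice_blocks N)) (principal (lattice_blocks M :: (int^'n) set set))"
    if "N \<in> {1..}" "M \<in> {1..}" for N M :: nat
    using that by (intro bexI[of _ "max N M"])
      (auto intro: subsetD[OF lattice_blocks_antimono, rotated])
  then show ?thesis
    unfolding large_blocks_def
    by (subst eventually_INF_base) (auto simp: eventually_principal)
qed

section \<open>Blocks as products of integer intervals\<close>

lemma lattice_block_eq_image:
  "lattice_block a l = vec_lambda ` PiE UNIV (\<lambda>k. {a $ k ..< a $ k + int (l $ k)})"
proof -
  have "x \<in> vec_lambda ` PiE UNIV (\<lambda>k. {a $ k ..< a $ k + int (l $ k)})"
    if "x \<in> lattice_block a l" for x
    using that by (intro image_eqI[of _ _ "vec_nth x"]) (auto simp: lattice_block_def)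
  then show ?thesis
    by (auto simp: lattice_block_def)
qed

lemma inj_vec_lambda: "inj_on vec_lambda A"
  by (auto simp: inj_on_def vec_lambda_inject)

lemma finite_lattice_block: "finite (lattice_block a (l :: nat^'n::finite))"
  unfolding lattice_block_eq_image by (intro finite_imageI finite_PiE) auto

lemma card_lattice_block: "card (lattice_block a (l :: nat^'n::finite)) = (\<Prod>k\<in>UNIV. l $ k)"
  unfolding lattice_block_eq_image by (subst card_image[OF inj_vec_lambda]) (simp add: card_PiE)

text \<open>Distributivity over a product set. It will split the sum of a character over a block
  into one-dimensional sums.\<close>

lemma sum_prod_lattice_block:
  fixes g :: "'n::finite \<Rightarrow> int \<Rightarrow> 'a::comm_semiring_1"
  shows "(\<Sum>x\<in>lattice_block a l. \<Prod>k\<in>UNIV. g k (x $ k)) =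
    (\<Prod>k\<in>UNIV. \<Sum>j\<in>{a $ k ..< a $ k + int (l $ k)}. g k j)"
  unfolding lattice_block_eq_image
  by (subst sum.reindex[OF inj_vec_lambda]) (simp add: prod_sum_PiE)

lemma lattice_blocksE:
  assumes "P \<in> lattice_blocks N"
  obtains a l where "P = lattice_block a l" "\<And>k. 1 \<le> l $ k" "\<And>k. N \<le> l $ k"
  using assms by (auto simp: lattice_blocks_iff)

lemma lattice_blocks_nonempty: "lattice_blocks N \<noteq> {}"
proof -
  \<comment> \<open>Sides \<open>Suc N\<close> instead of \<open>N\<close> keep the sides positive
    when \<open>N = 0\<close>.\<close>
  have "lattice_block 0 (\<chi> k. Suc N) \<in> lattice_blocks N"
    unfolding lattice_blocks_iff by (intro exI conjI allI) auto
  then show ?thesis by blast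
qed

lemma card_lattice_blocks_pos:
  assumes "P \<in> lattice_blocks N" shows "finite P" "card P > 0"
  using assms by (auto elim!: lattice_blocksE simp: finite_lattice_block card_lattice_block
      Suc_le_eq intro!: prod_pos)

lemma abs_block_mean_le:
  assumes P: "P \<in> lattice_blocks N" and B: "\<And>x. \<bar>f x\<bar> \<le> B"
  shows "\<bar>block_mean f P\<bar> \<le> B"
proof -
  have "\<bar>\<Sum>x\<in>P. f x\<bar> \<le> real (card P) * B"
    using sum_norm_bound[of P f B] B by simp
  then show ?thesis
    using card_lattice_blocks_pos[OF P] by (simp add: block_mean_def field_simps)
qed

lemma block_mean_mono:
  assumes "\<And>x. f x \<le> g x" shows "block_mean f P \<le> block_mean g P"
  unfolding block_mean_def by (intro divide_right_mono sum_mono assms) simp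

text \<open>Every infimum over a class is at most \<open>I\<close> and every supremum at least
  \<open>I\<close>, since each class contains arbitrarily large blocks. Convergence makes both come
  within any \<open>e\<close> of \<open>I\<close>.\<close>

lemma averageable_of_tendsto:
  fixes f :: "int^'n::finite \<Rightarrow> real"
  assumes bdd: "bounded (range f)" and lim: "(block_mean f \<longlongrightarrow> I) large_blocks"
  shows "averageable f" "average_value f = I"
proof -
  obtain B where B: "\<And>x. \<bar>f x\<bar> \<le> B"
    using bdd by (auto simp: bounded_iff)
  let ?L = "\<lambda>N. INF P\<in>lattice_blocks N. block_mean f P"
  let ?U = "\<lambda>N. SUP P\<in>lattice_blocks N. block_mean f P"
  have W: "-B \<le> block_mean f P" "block_mean f P \<le> B" if "P \<in> lattice_blocks N" for P N
    using abs_block_mean_le[of P N f B] that B by auto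
  have bb: "bdd_below (block_mean f ` lattice_blocks N)" and ba: "bdd_above (block_mean f ` lattice_blocks N)" for N
    using W by (auto intro!: bdd_belowI[of _ "-B"] bdd_aboveI[of _ B])
  have near: "\<exists>N\<ge>1. \<forall>P\<in>lattice_blocks N. I - e \<le> block_mean f P \<and> block_mean f P \<le> I + e"
    if "e > 0" for e
  proof -
    have "\<forall>\<^sub>F P in large_blocks. dist (block_mean f P) I < e"
      using lim that by (auto simp: tendsto_iff)
    then show ?thesis
      unfolding eventually_large_blocks by (fastforce simp: dist_real_def)
  qed
  have LI: "?L N \<le> I" and UI: "I \<le> ?U N" for N
  proof -
    have *: "?L N \<le> I + e \<and> I - e \<le> ?U N" if e: "e > 0" for e
    proof -
      obtain M where M: "\<forall>P\<in>lattice_blocks M. I - e \<le> block_mean f P \<and> block_mean f P \<le> I + e"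
        using near[OF e] by auto
      \<comment> \<open>A block lying in both classes links the infimum and supremum over the class
        of \<open>N\<close> to the estimates on that of \<open>M\<close>.\<close>
      obtain P :: "(int^'n) set" where P: "P \<in> lattice_blocks (max N M)"
        using lattice_blocks_nonempty by blast
      then have "P \<in> lattice_blocks N" "P \<in> lattice_blocks M"
        by (auto intro: subsetD[OF lattice_blocks_antimono, rotated])
      with M show ?thesis
        by (meson cINF_lower2[OF bb] cSUP_upper2[OF ba])
    qed
    show "?L N \<le> I" by (rule field_le_epsilon) (use * in auto)
    show "I \<le> ?U N" by (rule field_le_epsilon) (use * in force)
  qed
  have "lower_average f = I"
    unfolding lower_average_def
  proof (rule antisym)
    show "(SUP N\<in>{1..}. ?L N) \<le> I"
      by (rule cSUP_least) (use LI in auto)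
    show "I \<le> (SUP N\<in>{1..}. ?L N)"
    proof (rule field_le_epsilon)
      fix e :: real assume "e > 0"
      then obtain N where N: "N \<ge> 1" "\<forall>P\<in>lattice_blocks N. I - e \<le> block_mean f P"
        using near by meson
      have "I - e \<le> ?L N"
        using N lattice_blocks_nonempty by (intro cINF_greatest) auto
      also have "\<dots> \<le> (SUP N\<in>{1..}. ?L N)"
        using N LI by (intro cSUP_upper) (auto intro!: bdd_aboveI[of _ I])
      finally show "I \<le> (SUP N\<in>{1..}. ?L N) + e" by simp
    qed
  qed
  moreover have "upper_average f = I"
    unfolding upper_average_def
  proof (rule antisym)
    show "I \<le> (INF N\<in>{1..}. ?U N)"
      by (rule cINF_greatest) (use UI in auto)
    show "(INF N\<in>{1..}. ?U N) \<le> I"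
    proof (rule field_le_epsilon)
      fix e :: real assume "e > 0"
      then obtain N where N: "N \<ge> 1" "\<forall>P\<in>lattice_blocks N. block_mean f P \<le> I + e"
        using near by meson
      have "(INF N\<in>{1..}. ?U N) \<le> ?U N"
        using N UI by (intro cINF_lower) (auto intro!: bdd_belowI[of _ I])
      also have "?U N \<le> I + e"
        using N lattice_blocks_nonempty by (intro cSUP_least) auto
      finally show "(INF N\<in>{1..}. ?U N) \<le> I + e" .
    qed
  qed
  ultimately show "averageable f" "average_value f = I"
    using bdd by (auto simp: averageable_def average_value_def)
qed

definition torus_char :: "int^'m::finite \<Rightarrow> real^'m \<Rightarrow> complex" where
  "torus_char z u = cis (2 * pi * (real_vec z \<bullet> u))"

section \<open>Characters of the torus\<close>

lemma prod_cis: "(\<Prod>k\<in>A. cis (g k)) = cis (\<Sum>k\<in>A. g k)"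
  by (induction A rule: infinite_finite_induct) (simp_all add: cis_mult)

lemma real_vec_0: "real_vec 0 = 0"
  by (simp add: real_vec_def vec_eq_iff)

lemma torus_char_0: "torus_char 0 u = 1"
  by (simp add: torus_char_def real_vec_0)

lemma torus_char_add: "torus_char (z + w) u = torus_char z u * torus_char w u"
proof -
  have "real_vec (z + w) = real_vec z + real_vec w"
    by (simp add: real_vec_def vec_eq_iff)
  then show ?thesis
    by (simp add: torus_char_def cis_mult inner_add_left algebra_simps)
qed

section \<open>Integrals of characters over the unit cube\<close>

text \<open>Fubini for products of one-variable functions: \<open>lborel\<close> is the image of the
  product measure indexed by \<open>Basis\<close> under the coordinate map.\<close>

lemma integral_prod_Basis:
  fixes h :: "'a::euclidean_space \<Rightarrow> real \<Rightarrow> 'b::{real_normed_field,banach,second_countable_topology}"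
  assumes h: "\<And>b. b \<in> Basis \<Longrightarrow> integrable lborel (h b)"
  shows "(\<integral>x. (\<Prod>b\<in>Basis. h b (x \<bullet> b)) \<partial>lborel) = (\<Prod>b\<in>Basis. \<integral>t. h b t \<partial>lborel)"
proof -
  interpret product_sigma_finite "\<lambda>_::'a. interval_measure (\<lambda>x. x)"
    by (simp add: product_sigma_finite_def sigma_finite_interval_measure continuous_ident)
  have [measurable]: "h b \<in> borel_measurable borel" if "b \<in> Basis" for b
    using borel_measurable_integrable[OF h[OF that]] by simp
  have "(\<integral>x. (\<Prod>b\<in>Basis. h b (x \<bullet> b)) \<partial>lborel) =
      (\<integral>f. (\<Prod>b\<in>Basis. h b ((\<Sum>c\<in>Basis. f c *\<^sub>R c) \<bullet> b)) \<partial>(\<Pi>\<^sub>M b\<in>(Basis::'a set). interval_measure (\<lambda>x. x)))"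
    unfolding lborel_def by (rule integral_distr) auto
  also have "\<dots> = (\<integral>f. (\<Prod>b\<in>Basis. h b (f b)) \<partial>(\<Pi>\<^sub>M b\<in>(Basis::'a set). interval_measure (\<lambda>x. x)))"
    by (simp add: inner_sum_left inner_Basis if_distrib cong: if_cong)
  also have "\<dots> = (\<Prod>b\<in>Basis. \<integral>t. h b t \<partial>lborel)"
    using h by (subst product_integral_prod) (auto simp: lborel_eq_real)
  finally show ?thesis .
qed

lemma integral_cis_unit_interval:
  "(\<integral>t. indicator {0..1} t *\<^sub>R cis (2 * pi * (of_int j * t)) \<partial>lborel) = (if j = 0 then 1 else 0)"
proof (cases "j = 0")
  case False
  \<comment> \<open>This primitive agrees at 0 and 1 because \<open>j\<close> is an integer.\<close>
  let ?F = "\<lambda>t. cis (2 * pi * (of_int j * t)) / (2 * pi * of_int j * \<i>)"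
  have "(?F has_vector_derivative cis (2 * pi * (of_int j * t))) (at t within {0..1})" for t
  proof -
    let ?c = "2 * pi * of_int j * \<i>"
    have "((\<lambda>w. exp (?c * w) / ?c) has_field_derivative exp (?c * of_real t)) (at (of_real t))"
      using False by (auto intro!: derivative_eq_intros)
    from has_vector_derivative_real_field[OF this] show ?thesis
      by (simp add: cis_conv_exp mult_ac)
  qed
  then have "(\<integral>t. indicator {0..1} t *\<^sub>R cis (2 * pi * (of_int j * t)) \<partial>lborel) = ?F 1 - ?F 0"
    by (intro integral_FTC_atLeastAtMost continuous_intros) auto
  then show ?thesis
    using False by simp
qed simp

lemma continuous_on_torus_char: "continuous_on S (torus_char z)"
  unfolding torus_char_def by (intro continuous_intros)

text \<open>The character and the indicator of the cube both factor over the coordinates, and a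
  factor vanishes as soon as one entry of \<open>z\<close> is nonzero. The case \<open>z = 0\<close>
  later supplies the volume of the cube.\<close>

lemma torus_char_has_integral:
  fixes z :: "int^'m::finite"
  shows "(torus_char z has_integral (if z = 0 then 1 else 0)) (cbox 0 1)"
proof -
  let ?h = "\<lambda>(b::real^'m) t. indicator {0..1} t *\<^sub>R cis (2 * pi * ((real_vec z \<bullet> b) * t))"
  have int: "integrable lborel (?h b)" for b
    using borel_integrable_atLeastAtMost'[of 0 1 "\<lambda>t. cis (2 * pi * ((real_vec z \<bullet> b) * t))"]
    by (simp add: set_integrable_def continuous_intros)
  have eq: "indicator (cbox 0 1) u *\<^sub>R torus_char z u = (\<Prod>b\<in>Basis. ?h b (u \<bullet> b))" for u :: "real^'m"
  proof -
    have "(\<Prod>b\<in>Basis. indicator {0..1} (u \<bullet> b) :: real) = indicator (cbox 0 1) u"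
    proof -
      have "1 \<bullet> b = 1" if "b \<in> Basis" for b :: "real^'m"
        using that by (auto simp: Basis_vec_def inner_axis)
      then have "u \<in> cbox 0 1 \<longleftrightarrow> (\<forall>b\<in>Basis. u \<bullet> b \<in> {0..1})"
        by (simp add: mem_box)
      then show ?thesis
        by (cases "u \<in> cbox 0 1") (auto simp: indicator_def intro!: prod_zero)
    qed
    moreover have "real_vec z \<bullet> u = (\<Sum>b\<in>Basis. (real_vec z \<bullet> b) * (u \<bullet> b))"
      by (rule euclidean_inner)
    ultimately show ?thesis
      by (simp add: torus_char_def scaleR_conv_of_real prod.distrib sum_distrib_left prod_cis mult.assoc flip: of_real_prod)
  qed
  have "(\<integral>u. indicator (cbox 0 1) u *\<^sub>R torus_char z u \<partial>lborel) = (\<Prod>b\<in>Basis. \<integral>t. ?h b t \<partial>lborel)"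
    unfolding eq by (rule integral_prod_Basis[OF int])
  also have "\<dots> = (\<Prod>b\<in>(Basis::(real^'m) set). if real_vec z \<bullet> b = 0 then 1 else 0)"
  proof (rule prod.cong[OF refl])
    fix b :: "real^'m" assume "b \<in> Basis"
    then obtain k where "b = axis k 1" by (auto simp: Basis_vec_def)
    then have "real_vec z \<bullet> b = of_int (z $ k)" by (simp add: inner_axis real_vec_def)
    then show "(\<integral>t. ?h b t \<partial>lborel) = (if real_vec z \<bullet> b = 0 then 1 else 0)"
      by (simp add: integral_cis_unit_interval)
  qed
  also have "\<dots> = (if z = 0 then 1 else 0)"
  proof -
    have "z = 0 \<longleftrightarrow> (\<forall>b\<in>(Basis::(real^'m) set). real_vec z \<bullet> b = 0)"
      by (auto simp: vec_eq_iff Basis_vec_def inner_axis real_vec_def)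
    then show ?thesis by (auto intro!: prod_zero)
  qed
  finally have *: "integral\<^sup>L lborel (\<lambda>u. indicator (cbox 0 1) u *\<^sub>R torus_char z u) = (if z = 0 then 1 else 0)" .
  have "integrable lborel (\<lambda>u. indicator (cbox 0 1) u *\<^sub>R torus_char z u)"
    by (intro borel_integrable_compact continuous_on_torus_char compact_cbox)
  from has_integral_integral_lborel[OF this] show ?thesis
    unfolding * by (simp add: indicator_scaleR_eq_if has_integral_restrict_UNIV)
qed

section \<open>Nonresonance and means of characters along the orbit\<close>

text \<open>If all these entries were integers, the combination of the rows of \<Lambda> with
  coefficients \<open>z\<close> would equal an integer combination of the identity rows.
  Independence of the stacked rows then forces \<open>z = 0\<close>.\<close>

lemma nonresonant_non_integer:
  fixes \<Lambda> :: "real^'n::finite^'m::finite"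
  assumes "nonresonant \<Lambda>" and "z \<noteq> 0"
  shows "\<exists>k. (real_vec z v* \<Lambda>) $ k \<notin> \<int>"
proof (rule ccontr)
  interpret rat: vector_space "\<lambda>(q::rat) (v::real^'n). of_rat q *\<^sub>R v"
    by (rule vector_space_over_rat)
  let ?r = "\<lambda>i. row i (stack_identity \<Lambda>)"
  assume "\<not> ?thesis"
  then have "\<forall>k. \<exists>w. (real_vec z v* \<Lambda>) $ k = of_int w"
    by (auto elim: Ints_cases)
  then obtain w where w: "\<And>k. (real_vec z v* \<Lambda>) $ k = of_int (w k)"
    by metis
  define c :: "'n + 'm \<Rightarrow> rat" where
    "c = case_sum (\<lambda>k. - of_int (w k)) (\<lambda>i. of_int (z $ i))"
  have inj: "inj ?r" and indep: "rat.independent (range ?r)"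
    using assms(1) by (auto simp: nonresonant_def rows_def full_SetCompr_eq)
  have "(\<Sum>i\<in>UNIV. of_rat (c i) *\<^sub>R ?r i) $ j = 0" for j
  proof -
    have "(\<Sum>i\<in>UNIV. of_rat (c i) *\<^sub>R ?r i) $ j =
        (\<Sum>i\<in>UNIV <+> UNIV. of_rat (c i) * (?r i $ j))"
      by (simp add: sum_component)
    also have "\<dots> = (\<Sum>k\<in>UNIV. - (of_int (w k) * mat 1 $ k $ j)) +
        (\<Sum>i\<in>UNIV. of_int (z $ i) * \<Lambda> $ i $ j)"
      by (subst sum.Plus) (simp_all add: c_def row_def stack_identity_def of_rat_minus)
    also have "(\<Sum>k\<in>UNIV. - (real_of_int (w k) * mat 1 $ k $ j)) = - of_int (w j)"
      by (simp add: mat_def if_distrib sum_negf cong: if_cong)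
    also have "(\<Sum>i\<in>UNIV. of_int (z $ i) * \<Lambda> $ i $ j) = of_int (w j)"
      using w[of j] by (simp add: vector_matrix_mult_def real_vec_def mult.commute)
    finally show ?thesis by simp
  qed
  then have 0: "(\<Sum>i\<in>UNIV. of_rat (c i) *\<^sub>R ?r i) = 0"
    by (simp add: vec_eq_iff)
  \<comment> \<open>Independence refers to the set of rows, so the coefficients are moved from
    indices to rows; injectivity lets \<open>inv ?r\<close> recover the index.\<close>
  have "(\<Sum>v\<in>range ?r. of_rat (c (inv ?r v)) *\<^sub>R v) = 0"
    using 0 by (simp add: sum.reindex[OF inj] inv_f_f[OF inj])
  then have "c (inv ?r (?r i)) = 0" for i
    using rat.independentD[OF indep, of "range ?r" "\<lambda>v. c (inv ?r v)" "?r i"] by simp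
  then have "c (Inr i) = 0" for i
    by (simp add: inv_f_f[OF inj])
  then have "z = 0"
    by (simp add: c_def vec_eq_iff)
  with assms show False by simp
qed

lemma norm_sum_cis_le: "norm (\<Sum>j\<in>{a ..< a + int l}. cis (2 * pi * (\<theta> * of_int j))) \<le> real l"
  using sum_norm_bound[of "{a ..< a + int l}" "\<lambda>j. cis (2 * pi * (\<theta> * of_int j))" 1] by simp

lemma cis_2pi_eq_1_iff: "cis (2 * pi * t) = 1 \<longleftrightarrow> t \<in> \<int>"
proof
  assume "cis (2 * pi * t) = 1"
  then obtain n :: int where "2 * pi * t = of_int (2 * n) * pi"
    by (auto simp: cis_conv_exp exp_eq_1)
  then have "t = of_int n" by simp
  then show "t \<in> \<int>" by simp
qed simp

text \<open>A geometric sum with ratio different from 1. The bound depends neither on the starting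
  point nor on the length.\<close>

lemma norm_sum_cis_le_geometric:
  assumes "\<theta> \<notin> \<int>"
  shows "norm (\<Sum>j\<in>{a ..< a + int l}. cis (2 * pi * (\<theta> * of_int j)))
    \<le> 2 / norm (cis (2 * pi * \<theta>) - 1)"
proof -
  let ?q = "cis (2 * pi * \<theta>)"
  have "bij_betw (\<lambda>i. a + int i) {..<l} {a ..< a + int l}"
    by (rule bij_betwI[where g = "\<lambda>j. nat (j - a)"]) auto
  then have "(\<Sum>j\<in>{a ..< a + int l}. cis (2 * pi * (\<theta> * of_int j))) =
      (\<Sum>i<l. cis (2 * pi * (\<theta> * of_int (a + int i))))"
    by (rule sum.reindex_bij_betw[symmetric])
  also have "\<dots> = (\<Sum>i<l. cis (2 * pi * (\<theta> * of_int a)) * ?q ^ i)"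
    unfolding Complex.DeMoivre cis_mult by (simp add: algebra_simps)
  also have "\<dots> = cis (2 * pi * (\<theta> * of_int a)) * ((?q ^ l - 1) / (?q - 1))"
    using assms by (simp add: cis_2pi_eq_1_iff geometric_sum flip: sum_distrib_left)
  finally have "norm (\<Sum>j\<in>{a ..< a + int l}. cis (2 * pi * (\<theta> * of_int j))) =
      norm (?q ^ l - 1) / norm (?q - 1)"
    by (simp add: norm_mult norm_divide)
  also have "norm (?q ^ l - 1) \<le> 2"
    using norm_triangle_ineq4[of "?q ^ l" 1] by (simp add: norm_power)
  finally show ?thesis by (simp add: divide_right_mono)
qed

text \<open>Complex-valued counterpart of \<open>block_mean\<close>, with the passage to the orbit
  built in.\<close>

definition orbit_mean :: "real^'n::finite^'m::finite \<Rightarrow> (real^'m \<Rightarrow> complex) \<Rightarrow> (int^'n) set \<Rightarrow> complex" where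
  "orbit_mean \<Lambda> g P = (\<Sum>x\<in>P. g (\<Lambda> *v real_vec x)) / of_nat (card P)"

text \<open>The sum factors over the coordinates. The factor in direction \<open>k\<close> has a
  bound independent of the block, the others are at most their side lengths, and division by the
  cardinality leaves one side length in the denominator.\<close>

lemma norm_orbit_mean_torus_char_le:
  fixes \<Lambda> :: "real^'n::finite^'m::finite"
  assumes \<theta>: "(real_vec z v* \<Lambda>) $ k \<notin> \<int>" and P: "P \<in> lattice_blocks N" and N: "N \<ge> 1"
  shows "norm (orbit_mean \<Lambda> (torus_char z) P)
    \<le> 2 / norm (cis (2 * pi * (real_vec z v* \<Lambda>) $ k) - 1) / real N"
proof -
  let ?\<theta> = "real_vec z v* \<Lambda>"
  let ?C = "2 / norm (cis (2 * pi * ?\<theta> $ k) - 1)"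
  obtain a l where Peq: "P = lattice_block a l" and l: "\<And>k. 1 \<le> l $ k" "\<And>k. N \<le> l $ k"
    using P by (elim lattice_blocksE) blast
  \<comment> \<open>\<open>D\<close> counts the points of a cross-section of the block perpendicular
    to direction \<open>k\<close>; it cancels at the end.\<close>
  define D where "D = (\<Prod>i\<in>UNIV - {k}. real (l $ i))"
  let ?S = "\<lambda>k. \<Sum>j\<in>{a $ k ..< a $ k + int (l $ k)}. cis (2 * pi * (?\<theta> $ k * of_int j))"
  have "torus_char z (\<Lambda> *v real_vec x) = (\<Prod>k\<in>UNIV. cis (2 * pi * (?\<theta> $ k * of_int (x $ k))))"
    for x :: "int^'n"
  proof -
    \<comment> \<open>Moving \<Lambda> across the inner product exhibits \<open>?\<theta>\<close> as
      the frequency vector on the lattice.\<close>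
    have "real_vec z \<bullet> (\<Lambda> *v real_vec x) = (\<Sum>k\<in>UNIV. ?\<theta> $ k * of_int (x $ k))"
      by (subst dot_lmul_matrix[symmetric]) (simp add: inner_vec_def real_vec_def)
    then show ?thesis
      by (simp add: torus_char_def prod_cis sum_distrib_left)
  qed
  then have "norm (\<Sum>x\<in>P. torus_char z (\<Lambda> *v real_vec x)) = (\<Prod>k\<in>UNIV. norm (?S k))"
    using sum_prod_lattice_block[of "\<lambda>k j. cis (2 * pi * (?\<theta> $ k * of_int j))" a l]
    by (simp add: Peq prod_norm)
  also have "\<dots> = norm (?S k) * (\<Prod>i\<in>UNIV - {k}. norm (?S i))"
    by (simp add: prod.remove)
  also have "\<dots> \<le> ?C * D"
    unfolding D_def
    by (intro mult_mono prod_mono prod_nonneg conjI norm_sum_cis_le norm_sum_cis_le_geometric[OF \<theta>]) auto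
  finally have *: "norm (\<Sum>x\<in>P. torus_char z (\<Lambda> *v real_vec x)) \<le> ?C * D" .
  have card: "real (card P) = real (l $ k) * D"
    by (simp add: Peq card_lattice_block D_def prod.remove[of UNIV k])
  have pos: "D > 0" "real (l $ k) > 0"
    using l by (auto intro!: prod_pos simp: D_def Suc_le_eq)
  have "norm (orbit_mean \<Lambda> (torus_char z) P) \<le> ?C * D / real (card P)"
    unfolding orbit_mean_def norm_divide norm_of_nat by (rule divide_right_mono[OF *]) simp
  also have "\<dots> = ?C / real (l $ k)"
    using pos unfolding card by simp
  also have "\<dots> \<le> ?C / real N"
    using N l(2)[of k] by (intro divide_left_mono) auto
  finally show ?thesis .
qed

lemma orbit_mean_torus_char_tendsto:
  fixes \<Lambda> :: "real^'n::finite^'m::finite"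
  assumes "nonresonant \<Lambda>"
  shows "(orbit_mean \<Lambda> (torus_char z) \<longlongrightarrow> (if z = 0 then 1 else 0)) large_blocks"
proof (cases "z = 0")
  case True
  have "orbit_mean \<Lambda> (torus_char z) P = 1" if "P \<in> lattice_blocks 1" for P
    using card_lattice_blocks_pos[OF that] by (auto simp: True orbit_mean_def torus_char_0)
  then have "\<forall>\<^sub>F P in large_blocks. orbit_mean \<Lambda> (torus_char z) P = 1"
    unfolding eventually_large_blocks by (intro exI[of _ 1]) auto
  then show ?thesis
    by (simp add: True tendsto_eventually)
next
  case False
  then obtain k where k: "(real_vec z v* \<Lambda>) $ k \<notin> \<int>"
    using nonresonant_non_integer[OF assms] by blast
  define C where "C = 2 / norm (cis (2 * pi * (real_vec z v* \<Lambda>) $ k) - 1)"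
  have "\<forall>\<^sub>F P in large_blocks. dist (orbit_mean \<Lambda> (torus_char z) P) 0 < e" if e: "e > 0" for e
  proof -
    obtain N where N: "C / e < real N"
      using reals_Archimedean2 by blast
    \<comment> \<open>Passing to \<open>Suc N\<close> makes the index at least 1 without inspecting
      the sign of \<open>C\<close>.\<close>
    have "C / real (Suc N) < e"
      using N e by (simp add: field_simps)
    then have "norm (orbit_mean \<Lambda> (torus_char z) P) < e" if "P \<in> lattice_blocks (Suc N)" for P
      using norm_orbit_mean_torus_char_le[OF k that] unfolding C_def by simp
    then show ?thesis
      unfolding eventually_large_blocks by (intro exI[of _ "Suc N"]) auto
  qed
  then show ?thesis
    by (simp add: False tendsto_iff)
qed

section \<open>Trigonometric polynomials\<close>

text \<open>Only monomials and sums generate the class, so linear statements follow by induction;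
  closure under products is derived separately.\<close>

inductive trig_poly :: "(real^'m::finite \<Rightarrow> complex) \<Rightarrow> bool" where
  monomial: "trig_poly (\<lambda>u. c * torus_char z u)"
| add: "trig_poly p \<Longrightarrow> trig_poly q \<Longrightarrow> trig_poly (\<lambda>u. p u + q u)"

lemma trig_poly_mult:
  assumes "trig_poly p" "trig_poly q" shows "trig_poly (\<lambda>u. p u * q u)"
  using assms(1)
proof induction
  case (monomial c z)
  show ?case
    using assms(2)
  proof induction
    case (monomial d w)
    have "(\<lambda>u. c * torus_char z u * (d * torus_char w u)) = (\<lambda>u. (c * d) * torus_char (z + w) u)"
      by (simp add: torus_char_add fun_eq_iff)
    then show ?case using trig_poly.monomial by metis
  next
    case (add q1 q2)
    then show ?case by (simp add: distrib_left trig_poly.add)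
  qed
next
  case (add p1 p2)
  then show ?case by (simp add: distrib_right trig_poly.add)
qed

lemma trig_poly_const: "trig_poly (\<lambda>u. c)"
  using trig_poly.monomial[of c 0] by (simp add: torus_char_0)

text \<open>Integral and limit are both linear and agree on characters. The existential
  \<open>I\<close> carries the two through a single induction.\<close>

lemma trig_poly_equidistributed:
  fixes \<Lambda> :: "real^'n::finite^'m::finite"
  assumes "nonresonant \<Lambda>" and "trig_poly p"
  shows "\<exists>I. (p has_integral I) (cbox 0 1) \<and> (orbit_mean \<Lambda> p \<longlongrightarrow> I) large_blocks"
  using assms(2)
proof induction
  case (monomial c z)
  have "orbit_mean \<Lambda> (\<lambda>u. c * torus_char z u) = (\<lambda>P. c * orbit_mean \<Lambda> (torus_char z) P)"
    by (simp add: orbit_mean_def fun_eq_iff sum_distrib_left)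
  then show ?case
    using has_integral_mult_right[OF torus_char_has_integral, of c z]
      tendsto_mult_left[OF orbit_mean_torus_char_tendsto[OF assms(1)], of c z] by auto
next
  case (add p q)
  then obtain I J where "(p has_integral I) (cbox 0 1)" "(orbit_mean \<Lambda> p \<longlongrightarrow> I) large_blocks"
    "(q has_integral J) (cbox 0 1)" "(orbit_mean \<Lambda> q \<longlongrightarrow> J) large_blocks"
    by blast
  moreover have "orbit_mean \<Lambda> (\<lambda>u. p u + q u) = (\<lambda>P. orbit_mean \<Lambda> p P + orbit_mean \<Lambda> q P)"
    by (simp add: orbit_mean_def fun_eq_iff sum.distrib add_divide_distrib)
  ultimately show ?case
    by (auto intro!: exI[of _ "I + J"] has_integral_add tendsto_add)
qed

section \<open>Continuous functions on the torus\<close>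

text \<open>Realises the quotient torus as a product of unit circles, a compact subset of a
  Euclidean space.\<close>

definition torus_embed :: "real^'m::finite \<Rightarrow> complex^'m" where
  "torus_embed u = (\<chi> k. cis (2 * pi * u $ k))"

lemma continuous_on_torus_embed: "continuous_on S torus_embed"
  unfolding torus_embed_def by (intro continuous_intros)

lemma trig_poly_coordinate:
  fixes k :: "'m::finite"
  shows "trig_poly (\<lambda>u. complex_of_real (Re (torus_embed u $ k)))"
    and "trig_poly (\<lambda>u. complex_of_real (Im (torus_embed u $ k)))"
proof -
  have real_vec_axis: "real_vec (axis k j) \<bullet> u = of_int j * u $ k" for j and u :: "real^'m"
  proof -
    have "real_vec (axis k j) = (axis k (real_of_int j) :: real^'m)"
      by (simp add: real_vec_def axis_def vec_eq_iff)
    then show ?thesis by (simp add: inner_axis')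
  qed
  have "complex_of_real (Re (torus_embed u $ k)) =
      1/2 * torus_char (axis k 1) u + 1/2 * torus_char (axis k (-1)) u"
    and "complex_of_real (Im (torus_embed u $ k)) =
      (-\<i>/2) * torus_char (axis k 1) u + (\<i>/2) * torus_char (axis k (-1)) u" for u :: "real^'m"
    by (simp_all add: torus_embed_def torus_char_def real_vec_axis complex_eq_iff)
  then show "trig_poly (\<lambda>u::real^'m. complex_of_real (Re (torus_embed u $ k)))"
    "trig_poly (\<lambda>u::real^'m. complex_of_real (Im (torus_embed u $ k)))"
    by (simp_all only:) (intro trig_poly.intros)+
qed

text \<open>Stone-Weierstrass on the product \<open>T\<close> of unit circles. Real and imaginary
  parts of the coordinates separate its points, and by Euler's formulas they pull back to
  trigonometric polynomials.\<close>

lemma trig_poly_dense: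
  fixes F :: "complex^'m::finite \<Rightarrow> real"
  assumes F: "continuous_on UNIV F" and e: "e > 0"
  shows "\<exists>g. trig_poly (\<lambda>u. complex_of_real (g u)) \<and> (\<forall>u. \<bar>F (torus_embed u) - g u\<bar> < e)"
proof -
  define T where "T = {w::complex^'m. \<forall>k. norm (w $ k) = 1}"
  \<comment> \<open>The theorem applied here concerns algebras of real functions, hence the coercion
    of the pullback to complex values.\<close>
  define R :: "(complex^'m \<Rightarrow> real) set" where
    "R = {g. continuous_on T g \<and> trig_poly (\<lambda>u. complex_of_real (g (torus_embed u)))}"
  interpret function_ring_on R T
  proof
    have "closed T"
      unfolding T_def by (intro closed_Collect_all closed_Collect_eq continuous_intros)
    moreover have "norm w \<le> real CARD('m)" if "w \<in> T" for w
    proof -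
      have "norm w \<le> (\<Sum>k\<in>UNIV. norm (w $ k))"
        unfolding norm_vec_def by (rule L2_set_le_sum) simp
      also have "\<dots> = real CARD('m)"
        using that by (simp add: T_def)
      finally show ?thesis .
    qed
    then have "bounded T" by (auto simp: bounded_iff)
    ultimately show "compact T" by (simp add: compact_eq_bounded_closed)
  next
    fix w w' assume "w \<in> T" "w' \<in> T" "w \<noteq> w'"
    then obtain k where "w $ k \<noteq> w' $ k" by (auto simp: vec_eq_iff)
    then have "Re (w $ k) \<noteq> Re (w' $ k) \<or> Im (w $ k) \<noteq> Im (w' $ k)"
      by (auto simp: complex_eq_iff)
    then show "\<exists>g\<in>R. g w \<noteq> g w'"
    proof
      assume "Re (w $ k) \<noteq> Re (w' $ k)"
      then show ?thesis
        by (intro bexI[of _ "\<lambda>w. Re (w $ k)"])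
          (auto simp: R_def trig_poly_coordinate intro!: continuous_intros)
    next
      assume "Im (w $ k) \<noteq> Im (w' $ k)"
      then show ?thesis
        by (intro bexI[of _ "\<lambda>w. Im (w $ k)"])
          (auto simp: R_def trig_poly_coordinate intro!: continuous_intros)
    qed
  next
    fix g h assume "g \<in> R" "h \<in> R"
    then show "(\<lambda>w. g w + h w) \<in> R" "(\<lambda>w. g w * h w) \<in> R"
      using trig_poly.add[of "\<lambda>u. complex_of_real (g (torus_embed u))" "\<lambda>u. complex_of_real (h (torus_embed u))"]
        trig_poly_mult[of "\<lambda>u. complex_of_real (g (torus_embed u))" "\<lambda>u. complex_of_real (h (torus_embed u))"]
      by (simp_all add: R_def continuous_on_add continuous_on_mult)
  next
    show "continuous_on T g" if "g \<in> R" for g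
      using that by (simp add: R_def)
    show "(\<lambda>_. c) \<in> R" for c
      by (simp add: R_def trig_poly_const)
  qed
  obtain g where "g \<in> R" "\<forall>w\<in>T. \<bar>F w - g w\<bar> < e"
    using Stone_Weierstrass_basic[OF continuous_on_subset[OF F] e] by auto
  moreover have "torus_embed u \<in> T" for u
    by (simp add: T_def torus_embed_def)
  ultimately show ?thesis
    by (intro exI[of _ "g \<circ> torus_embed"]) (auto simp: R_def)
qed

lemma block_mean_diff: "block_mean (\<lambda>x. f x - g x) P = block_mean f P - block_mean g P"
  by (simp add: block_mean_def sum_subtractf diff_divide_distrib)

text \<open>A trigonometric polynomial uniformly within \<open>e / 3\<close> changes the mean and
  the integral by at most \<open>e / 3\<close> each; its own convergence accounts for the last
  third.\<close>

lemma continuous_block_mean_tendsto: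
  fixes \<Lambda> :: "real^'n::finite^'m::finite" and F :: "complex^'m \<Rightarrow> real"
  assumes \<Lambda>: "nonresonant \<Lambda>" and F: "continuous_on UNIV F"
  shows "(block_mean (\<lambda>x::int^'n. F (torus_embed (\<Lambda> *v real_vec x)))
      \<longlongrightarrow> integral (cbox 0 1) (\<lambda>u. F (torus_embed u))) large_blocks"
proof -
  have int: "(\<lambda>u. F (torus_embed u)) integrable_on cbox 0 1"
    by (intro integrable_continuous continuous_on_compose2[OF F continuous_on_torus_embed]) auto
  let ?J = "integral (cbox 0 1) (\<lambda>u. F (torus_embed u))"
  let ?F = "\<lambda>x::int^'n. F (torus_embed (\<Lambda> *v real_vec x))"
  \<comment> \<open>The volume is read off from the integral of the trivial character, by uniqueness
    of integrals.\<close>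
  have content: "measure lborel (cbox (0::real^'m) 1) = 1"
  proof -
    have "torus_char (0::int^'m) = (\<lambda>u. 1)"
      by (simp add: torus_char_0 fun_eq_iff)
    then have "((\<lambda>u::real^'m. 1::complex) has_integral 1) (cbox 0 1)"
      using torus_char_has_integral[of "0::int^'m"] by simp
    from has_integral_unique[OF this has_integral_const] show ?thesis
      by (simp add: scaleR_conv_of_real)
  qed
  have "\<forall>\<^sub>F P in large_blocks. dist (block_mean ?F P) ?J < e" if e: "e > 0" for e
  proof -
    obtain g where g: "trig_poly (\<lambda>u. complex_of_real (g u))"
      and Fg: "\<And>u. \<bar>F (torus_embed u) - g u\<bar> < e / 3"
      using trig_poly_dense[OF F, of "e / 3"] e by auto
    let ?g = "\<lambda>x::int^'n. g (\<Lambda> *v real_vec x)"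
    obtain I where I: "((\<lambda>u. complex_of_real (g u)) has_integral I) (cbox 0 1)"
      and lim: "(orbit_mean \<Lambda> (\<lambda>u. complex_of_real (g u)) \<longlongrightarrow> I) large_blocks"
      using trig_poly_equidistributed[OF \<Lambda> g] by blast
    have "(g has_integral Re I) (cbox 0 1)"
      using has_integral_Re[OF I] by simp
    then have "((\<lambda>u. F (torus_embed u) - g u) has_integral ?J - Re I) (cbox 0 1)"
      using int by (intro has_integral_diff integrable_integral)
    then have J: "\<bar>?J - Re I\<bar> \<le> e / 3"
      using has_integral_bound[of "e / 3" "\<lambda>u. F (torus_embed u) - g u"] Fg e
      by (force simp: content less_imp_le)
    have "Re (orbit_mean \<Lambda> (\<lambda>u. complex_of_real (g u)) P) = block_mean ?g P" for P
      by (simp add: orbit_mean_def block_mean_def flip: of_real_sum)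
    then have "(block_mean ?g \<longlongrightarrow> Re I) large_blocks"
      using tendsto_Re[OF lim] by simp
    then have "\<forall>\<^sub>F P in large_blocks. dist (block_mean ?g P) (Re I) < e / 3"
      using e by (intro tendstoD) simp_all
    moreover have "\<forall>\<^sub>F P in large_blocks. P \<in> lattice_blocks 1"
      unfolding eventually_large_blocks by auto
    ultimately show ?thesis
    proof eventually_elim
      case (elim P)
      have "\<bar>block_mean ?F P - block_mean ?g P\<bar> \<le> e / 3"
        unfolding block_mean_diff[symmetric]
        using Fg by (intro abs_block_mean_le[OF elim(2)] less_imp_le)
      with elim(1) J show ?case
        unfolding dist_real_def by linarith
    qed
  qed
  then show "(block_mean ?F \<longlongrightarrow> ?J) large_blocks"
    by (simp add: tendsto_iff)
qed

section \<open>Closeness on the torus lifted to closeness modulo integers\<close>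

text \<open>Continuity of \<open>Ln\<close> at 1, applied to the quotient of the two points.
  Rotations are isometries, so \<eta> is uniform in \<open>s\<close> and \<open>t\<close>; the
  integer \<open>n\<close> comes from the period of \<open>exp\<close>.\<close>

lemma cis_close_imp:
  assumes "\<delta> > 0"
  shows "\<exists>\<eta>>0. \<forall>s t. norm (cis (2 * pi * s) - cis (2 * pi * t)) < \<eta> \<longrightarrow>
    (\<exists>n::int. \<bar>s + of_int n - t\<bar> < \<delta>)"
proof -
  have "isCont Ln 1" by (rule isCont_Ln') (auto simp: complex_nonpos_Reals_iff)
  moreover have "2 * pi * \<delta> > 0" using assms by simp
  ultimately obtain \<eta> where \<eta>: "\<eta> > 0" "\<And>w. dist w 1 < \<eta> \<Longrightarrow> dist (Ln w) (Ln 1) < 2 * pi * \<delta>"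
    unfolding continuous_at_eps_delta by blast
  have "\<exists>n::int. \<bar>s + of_int n - t\<bar> < \<delta>"
    if "norm (cis (2 * pi * s) - cis (2 * pi * t)) < \<eta>" for s t
  proof -
    let ?w = "cis (2 * pi * (s - t))"
    have "cis (2 * pi * s) - cis (2 * pi * t) = cis (2 * pi * t) * (?w - 1)"
      by (simp add: algebra_simps cis_mult)
    then have "dist ?w 1 < \<eta>"
      using that by (simp add: norm_mult dist_norm)
    then have Ln: "norm (Ln ?w) < 2 * pi * \<delta>"
      using \<eta>(2)[of ?w] by simp
    have "exp (Ln ?w) = exp (\<i> * of_real (2 * pi * (s - t)))"
      by (simp add: cis_conv_exp)
    then obtain n :: int where n: "Ln ?w = \<i> * of_real (2 * pi * (s - t)) + of_int (2 * n) * pi * \<i>"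
      unfolding exp_eq by auto
    have "Ln ?w = of_real (2 * pi * (s + of_int n - t)) * \<i>"
      unfolding n by (simp add: algebra_simps)
    then have "norm (Ln ?w) = \<bar>2 * pi * (s + of_int n - t)\<bar>"
      by (simp only: norm_mult norm_of_real norm_ii mult_1_right)
    then have "2 * pi * \<bar>s + of_int n - t\<bar> < 2 * pi * \<delta>"
      using Ln by (simp add: abs_mult)
    then show ?thesis by (intro exI[of _ n]) simp
  qed
  with \<eta>(1) show ?thesis by blast
qed

lemma torus_embed_close_imp:
  assumes "\<delta> > 0"
  shows "\<exists>\<eta>>0. \<forall>u v::real^'m::finite. dist (torus_embed u) (torus_embed v) < \<eta> \<longrightarrow>
    (\<exists>z. dist (u + real_vec z) v < \<delta>)"
proof -
  \<comment> \<open>The distance is at most the sum of the coordinate errors, so each coordinate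
    gets an equal share of \<delta>.\<close>
  let ?\<delta> = "\<delta> / real CARD('m)"
  have "?\<delta> > 0" using assms by simp
  then obtain \<eta> where \<eta>: "\<eta> > 0" "\<And>s t. norm (cis (2 * pi * s) - cis (2 * pi * t)) < \<eta> \<Longrightarrow>
      \<exists>n::int. \<bar>s + of_int n - t\<bar> < ?\<delta>"
    using cis_close_imp by meson
  have "\<exists>z. dist (u + real_vec z) v < \<delta>"
    if uv: "dist (torus_embed u) (torus_embed v) < \<eta>" for u v :: "real^'m"
  proof -
    have "\<exists>n::int. \<bar>u $ k + of_int n - v $ k\<bar> < ?\<delta>" for k
      using dist_vec_nth_le[of "torus_embed u" k "torus_embed v"] uv
      by (intro \<eta>(2)) (simp add: torus_embed_def dist_norm)
    then obtain n :: "'m \<Rightarrow> int" where n: "\<And>k. \<bar>u $ k + of_int (n k) - v $ k\<bar> < ?\<delta>"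
      by metis
    have "dist (u + real_vec (\<chi> k. n k)) v \<le> (\<Sum>k\<in>UNIV. \<bar>u $ k + of_int (n k) - v $ k\<bar>)"
      using norm_le_l1_cart[of "u + real_vec (\<chi> k. n k) - v"] by (simp add: dist_norm real_vec_def)
    also have "\<dots> < (\<Sum>k\<in>(UNIV::'m set). ?\<delta>)"
      using n by (intro sum_strict_mono) auto
    finally show ?thesis by auto
  qed
  with \<eta>(1) show ?thesis by blast
qed

section \<open>Almost everywhere continuous functions\<close>

text \<open>
  The distance is measured after embedding the torus into complex space, so the
  envelope is a Lipschitz function there, and no function on the torus has to be lifted.
\<close>

definition upper_envelope :: "(real^'m::finite \<Rightarrow> real) \<Rightarrow> nat \<Rightarrow> complex^'m \<Rightarrow> real" where
  "upper_envelope f n w = (SUP v. f v - real n * dist w (torus_embed v))"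

context
  fixes f :: "real^'m::finite \<Rightarrow> real" and B :: real
  assumes B: "\<And>u. \<bar>f u\<bar> \<le> B"
begin

lemma bdd_above_upper_envelope: "bdd_above (range (\<lambda>v. f v - real n * dist w (torus_embed v)))"
proof (rule bdd_aboveI2)
  show "f v - real n * dist w (torus_embed v) \<le> B" for v
    using B[of v] mult_nonneg_nonneg[OF of_nat_0_le_iff[of n] zero_le_dist[of w "torus_embed v"]]
      by linarith
qed

lemma upper_envelope_ge: "f v - real n * dist w (torus_embed v) \<le> upper_envelope f n w"
  unfolding upper_envelope_def by (intro cSUP_upper bdd_above_upper_envelope) simp

lemma le_upper_envelope: "f u \<le> upper_envelope f n (torus_embed u)"
  using upper_envelope_ge[of u n "torus_embed u"] by simp

lemma abs_upper_envelope_le: "\<bar>upper_envelope f n (torus_embed u)\<bar> \<le> B"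
proof -
  have "upper_envelope f n (torus_embed u) \<le> B"
    unfolding upper_envelope_def
  proof (rule cSUP_least)
    show "f v - real n * dist (torus_embed u) (torus_embed v) \<le> B" for v
      using B[of v] mult_nonneg_nonneg[OF of_nat_0_le_iff[of n] zero_le_dist[of "torus_embed u" "torus_embed v"]]
        by linarith
  qed simp
  with le_upper_envelope[of u n] B[of u] show ?thesis by simp
qed

text \<open>A finite supremum of functions with Lipschitz constant \<open>n\<close> has the same
  constant, by the triangle inequality.\<close>

lemma continuous_on_upper_envelope: "continuous_on UNIV (upper_envelope f n)"
proof -
  have le: "upper_envelope f n w \<le> upper_envelope f n w' + real n * dist w w'" for w w'
    unfolding upper_envelope_def[of f n w]
  proof (rule cSUP_least)
    fix v
    have "real n * dist w' (torus_embed v) \<le> real n * (dist w w' + dist w (torus_embed v))"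
      by (intro mult_left_mono dist_triangle3) simp
    then show "f v - real n * dist w (torus_embed v) \<le> upper_envelope f n w' + real n * dist w w'"
      using upper_envelope_ge[of v n w'] by (simp add: distrib_left)
  qed simp
  have "(real n)-lipschitz_on UNIV (upper_envelope f n)"
  proof (rule lipschitz_onI)
    show "dist (upper_envelope f n w) (upper_envelope f n w') \<le> real n * dist w w'" for w w'
      using le[of w w'] le[of w' w] by (simp add: dist_real_def dist_commute abs_le_iff)
  qed simp
  then show ?thesis by (rule lipschitz_on_continuous_on)
qed

text \<open>Points \<open>v\<close> whose image is close to that of \<open>u\<close> have an integer
  translate near \<open>u\<close>, where continuity and periodicity bound \<open>f v\<close>. For
  all other \<open>v\<close> the penalty term eventually outweighs any gain in
  \<open>f\<close>.\<close>

lemma upper_envelope_tendsto: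
  assumes per: "unit_periodic f" and cont: "isCont f u"
  shows "(\<lambda>n. upper_envelope f n (torus_embed u)) \<longlonglongrightarrow> f u"
proof (rule LIMSEQ_I)
  fix e :: real assume "e > 0"
  then have "e / 2 > 0" by simp
  with cont obtain \<delta> where \<delta>: "\<delta> > 0" "\<And>v. dist v u < \<delta> \<Longrightarrow> dist (f v) (f u) < e / 2"
    unfolding continuous_at_eps_delta by blast
  obtain \<eta> where \<eta>: "\<eta> > 0"
    "\<And>v. dist (torus_embed v) (torus_embed u) < \<eta> \<Longrightarrow> \<exists>z. dist (v + real_vec z) u < \<delta>"
    using torus_embed_close_imp[OF \<delta>(1)] by meson
  \<comment> \<open>Two values of \<open>f\<close> differ by at most \<open>2 * B\<close>; from
    \<open>N\<close> on, the penalty at distance \<eta> exceeds this.\<close>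
  obtain N where N: "2 * B / \<eta> < real N"
    using reals_Archimedean2 by blast
  have "norm (upper_envelope f n (torus_embed u) - f u) < e" if "n \<ge> N" for n
  proof -
    have "upper_envelope f n (torus_embed u) \<le> f u + e / 2"
      unfolding upper_envelope_def
    proof (rule cSUP_least)
      fix v
      show "f v - real n * dist (torus_embed u) (torus_embed v) \<le> f u + e / 2"
      proof (cases "dist (torus_embed v) (torus_embed u) < \<eta>")
        case True
        then obtain z where "dist (v + real_vec z) u < \<delta>" using \<eta>(2) by blast
        then have "dist (f (v + real_vec z)) (f u) < e / 2" by (rule \<delta>(2))
        moreover have "f (v + real_vec z) = f v"
          using per by (simp add: unit_periodic_def)
        moreover have "real n * dist (torus_embed u) (torus_embed v) \<ge> 0"
          by simp
        ultimately show ?thesis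
          unfolding dist_real_def by linarith
      next
        case False
        have "2 * B < real N * \<eta>"
          using N \<eta>(1) by (simp add: field_simps)
        also have "real N * \<eta> \<le> real n * dist (torus_embed u) (torus_embed v)"
          using that False \<eta>(1) by (intro mult_mono) (auto simp: dist_commute)
        finally show ?thesis
          using B[of v] B[of u] \<open>e > 0\<close> by linarith
      qed
    qed simp
    with le_upper_envelope[of u n] \<open>e > 0\<close> show ?thesis by simp
  qed
  then show "\<exists>N. \<forall>n\<ge>N. norm (upper_envelope f n (torus_embed u) - f u) < e"
    by blast
qed

text \<open>Dominated convergence with the constant \<open>B\<close> as majorant. Integrability of
  \<open>f\<close> comes out as integrability of the limit function.\<close>

lemma integral_upper_envelope_tendsto:
  assumes "unit_periodic f" and "mes_continuous f"
  shows "f integrable_on cbox 0 1"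
    and "(\<lambda>n. integral (cbox 0 1) (\<lambda>u. upper_envelope f n (torus_embed u)))
      \<longlonglongrightarrow> integral (cbox 0 1) f"
proof -
  define D where "D = {u. \<not> isCont f u}"
  have D: "negligible D"
    using assms(2) by (simp add: D_def mes_continuous_def negligible_iff_null_sets)
  \<comment> \<open>Convergence is required at every point of the domain, so the null set
    \<open>D\<close> is removed from the cube, which leaves integrals unchanged.\<close>
  have spike: "(g has_integral y) (cbox 0 1 - D) \<longleftrightarrow> (g has_integral y) (cbox 0 1)"
    for g :: "real^'m \<Rightarrow> real" and y
    by (rule has_integral_spike_set_eq) (auto intro: negligible_subset[OF D])
  have spike': "integral (cbox 0 1 - D) g = integral (cbox 0 1) g"
    "g integrable_on (cbox 0 1 - D) \<longleftrightarrow> g integrable_on (cbox 0 1)" for g :: "real^'m \<Rightarrow> real"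
    by (simp_all add: integral_def integrable_on_def spike)
  have 1: "(\<lambda>u. upper_envelope f n (torus_embed u)) integrable_on cbox 0 1 - D" for n
    unfolding spike'
    by (intro integrable_continuous
        continuous_on_compose2[OF continuous_on_upper_envelope continuous_on_torus_embed]) auto
  have 2: "(\<lambda>u::real^'m. B) integrable_on cbox 0 1 - D"
    unfolding spike' by (rule integrable_const)
  have 3: "norm (upper_envelope f n (torus_embed u)) \<le> B" for n u
    using abs_upper_envelope_le by simp
  have 4: "(\<lambda>n. upper_envelope f n (torus_embed u)) \<longlonglongrightarrow> f u" if "u \<in> cbox 0 1 - D" for u
    using that upper_envelope_tendsto[OF assms(1)] by (auto simp: D_def)
  show "f integrable_on cbox 0 1"
    using dominated_convergence(1)[OF 1 2 3 4] by (simp only: spike')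
  show "(\<lambda>n. integral (cbox 0 1) (\<lambda>u. upper_envelope f n (torus_embed u)))
      \<longlonglongrightarrow> integral (cbox 0 1) f"
    using dominated_convergence(2)[OF 1 2 3 4] by (simp only: spike')
qed

text \<open>An envelope is a continuous majorant of \<open>f\<close>. For large \<open>n\<close> its
  integral is within \<open>e / 2\<close> of that of \<open>f\<close>, and its block means converge
  to that integral.\<close>

lemma eventually_block_mean_le:
  fixes \<Lambda> :: "real^'n::finite^'m"
  assumes \<Lambda>: "nonresonant \<Lambda>" and f: "unit_periodic f" "mes_continuous f" and e: "e > 0"
  shows "\<forall>\<^sub>F P in large_blocks.
    block_mean (\<lambda>x::int^'n. f (\<Lambda> *v real_vec x)) P < integral (cbox 0 1) f + e"
proof -
  let ?F = "\<lambda>n u. upper_envelope f n (torus_embed u)"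
  have "\<forall>\<^sub>F n in sequentially. integral (cbox 0 1) (?F n) < integral (cbox 0 1) f + e / 2"
    using integral_upper_envelope_tendsto(2)[OF f] by (rule order_tendstoD) (use e in simp)
  then obtain n where n: "integral (cbox 0 1) (?F n) < integral (cbox 0 1) f + e / 2"
    by (meson eventually_happens sequentially_bot)
  have "\<forall>\<^sub>F P in large_blocks. block_mean (\<lambda>x::int^'n. ?F n (\<Lambda> *v real_vec x)) P
      < integral (cbox 0 1) f + e"
    using continuous_block_mean_tendsto[OF \<Lambda> continuous_on_upper_envelope]
    by (rule order_tendstoD) (use n e in simp)
  then show ?thesis
    by eventually_elim (rule le_less_trans[OF block_mean_mono], rule le_upper_envelope)
qed

end

text \<open>\<open>has_integral\<close> asserts integrability as well as the value, whereas
  \<open>integral\<close> defaults to 0 for a function that is not integrable.\<close>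

theorem theorem2:
  fixes \<Lambda> :: "real^'n::finite^'m::finite" and f :: "real^'m \<Rightarrow> real"
  assumes "nonresonant \<Lambda>"
    and "unit_periodic f"
    and "mes_continuous f"
    and "bounded (range f)"
  shows "averageable (\<lambda>x::int^'n. f (\<Lambda> *v real_vec x)) \<and>
         (f has_integral average_value (\<lambda>x::int^'n. f (\<Lambda> *v real_vec x))) (cbox 0 1)"
proof -
  let ?h = "\<lambda>x::int^'n. f (\<Lambda> *v real_vec x)"
  let ?I = "integral (cbox 0 1) f"
  obtain B where B: "\<And>u. \<bar>f u\<bar> \<le> B"
    using assms(4) by (auto simp: bounded_iff)
  have minus_cont: "isCont (\<lambda>u. - f u) u \<longleftrightarrow> isCont f u" for u
    using continuous_minus[of "at u" f] continuous_minus[of "at u" "\<lambda>u. - f u"] by auto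
  have neg: "\<And>u. \<bar>- f u\<bar> \<le> B" "unit_periodic (\<lambda>u. - f u)" "mes_continuous (\<lambda>u. - f u)"
    using B assms(2,3) by (simp_all add: unit_periodic_def mes_continuous_def minus_cont)
  \<comment> \<open>The upper estimate for \<open>- f\<close> is the lower estimate for
    \<open>f\<close>, since means and integrals change sign with the function.\<close>
  have "\<forall>\<^sub>F P in large_blocks. dist (block_mean ?h P) ?I < e" if "e > 0" for e
    using eventually_block_mean_le[OF B assms(1-3) that]
      eventually_block_mean_le[OF neg(1) assms(1) neg(2,3) that]
  proof eventually_elim
    case (elim P)
    then show ?case
      by (simp add: block_mean_def sum_negf dist_real_def abs_less_iff)
  qed
  then have lim: "(block_mean ?h \<longlongrightarrow> ?I) large_blocks"
    by (simp add: tendsto_iff)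
  have "bounded (range ?h)"
    using assms(4) by (rule bounded_subset) auto
  then show ?thesis
    using averageable_of_tendsto[OF _ lim] integrable_integral[OF integral_upper_envelope_tendsto(1)[OF B assms(2,3)]]
    by simp
qed

end
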